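(* Let $G$ be an $r$-regular graph and $H$ an $s$-regular graph, and suppose $H$ is $1$-factorable. Then the Cartesian product $G\square H$ is $\mu$-simultaneous edge colorable for every positive integer $\mu\le r+s$.
   Context: All graphs are finite and simple; $[l]=\{1,\ldots,l\}$. A $\mu$-simultaneous edge coloring of a graph $G$ is a $\mu$-tuple $(c_1,\ldots,c_\mu)$ of proper edge colorings $c_i:E(G)\to[l]$ (with a common color set $[l]$) such that (1) for every vertex $v$, the set $\{c_i(e): e \text{ incident to } v\}$ is the same for all $i$, and (2) $c_i(e)\neq c_j(e)$ for every edge $e$ and all $i\neq j$; $G$ is $\mu$-simultaneous edge colorable if such a coloring exists for some $l$. A graph is $1$-factorable if its edge set is a disjoint union of perfect matchings. The Cartesian product $G\square H$ has vertex set $V(G)\times V(H)$, with $(u,v)$ adjacent to $(u',v')$ iff either $u=u'$ and $vv'\in E(H)$, or $uu'\in E(G)$ and $v=v'$. *)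

theory Defs
  imports Main "HOL-Library.Disjoint_Sets"
begin

record 'a ugraph =
  verts :: "'a set"
  edges :: "'a set set"

definition simple_graph :: "'a ugraph \<Rightarrow> bool" where
  "simple_graph G \<longleftrightarrow>
     finite (verts G) \<and> (\<forall>e\<in>edges G. e \<subseteq> verts G \<and> card e = 2)"

definition incident_edges :: "'a ugraph \<Rightarrow> 'a \<Rightarrow> 'a set set" where
  "incident_edges G v = {e \<in> edges G. v \<in> e}"

definition regular :: "'a ugraph \<Rightarrow> nat \<Rightarrow> bool" where
  "regular G r \<longleftrightarrow> (\<forall>v\<in>verts G. card (incident_edges G v) = r)"

definition perfect_matching :: "'a ugraph \<Rightarrow> 'a set set \<Rightarrow> bool" where
  "perfect_matching G M \<longleftrightarrow>
     M \<subseteq> edges G \<and> (\<forall>v\<in>verts G. \<exists>!e. e \<in> M \<and> v \<in> e)"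

text \<open>The union is over a nonempty family of perfect matchings. Hence an edgeless graph with
  at least one vertex is not 1-factorable: it has no perfect matching.\<close>

definition one_factorable :: "'a ugraph \<Rightarrow> bool" where
  "one_factorable G \<longleftrightarrow>
     (\<exists>F. F \<noteq> {} \<and> (\<forall>M\<in>F. perfect_matching G M) \<and> disjoint F \<and> \<Union>F = edges G)"

definition cartesian_product :: "'a ugraph \<Rightarrow> 'b ugraph \<Rightarrow> ('a \<times> 'b) ugraph"
  (infixl \<open>\<box>\<close> 70) where
  "G \<box> H =
     \<lparr>verts = verts G \<times> verts H,
      edges = {{(u, v), (u', v')} | u v u' v'.
        (u, v) \<in> verts G \<times> verts H \<and> (u', v') \<in> verts G \<times> verts H \<and>
        (u = u' \<and> {v, v'} \<in> edges H \<or> {u, u'} \<in> edges G \<and> v = v')}\<rparr>"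

definition proper_edge_coloring :: "'a ugraph \<Rightarrow> nat \<Rightarrow> ('a set \<Rightarrow> nat) \<Rightarrow> bool" where
  "proper_edge_coloring G l c \<longleftrightarrow>
     (\<forall>e\<in>edges G. c e \<in> {1..l}) \<and>
     (\<forall>e\<in>edges G. \<forall>e'\<in>edges G. e \<noteq> e' \<and> e \<inter> e' \<noteq> {} \<longrightarrow> c e \<noteq> c e')"

text \<open>A tuple of \<open>\<mu>\<close> colorings is a function of which only the values at \<open>1, \<dots>, \<mu>\<close> matter.\<close>

definition simultaneous_edge_coloring ::
  "'a ugraph \<Rightarrow> nat \<Rightarrow> nat \<Rightarrow> (nat \<Rightarrow> 'a set \<Rightarrow> nat) \<Rightarrow> bool" where
  "simultaneous_edge_coloring G \<mu> l c \<longleftrightarrow>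
     (\<forall>i\<in>{1..\<mu>}. proper_edge_coloring G l (c i)) \<and>
     (\<forall>v\<in>verts G. \<forall>i\<in>{1..\<mu>}. \<forall>j\<in>{1..\<mu>}.
        c i ` incident_edges G v = c j ` incident_edges G v) \<and>
     (\<forall>e\<in>edges G. \<forall>i\<in>{1..\<mu>}. \<forall>j\<in>{1..\<mu>}. i \<noteq> j \<longrightarrow> c i e \<noteq> c j e)"

definition simultaneous_edge_colorable :: "'a ugraph \<Rightarrow> nat \<Rightarrow> bool" where
  "simultaneous_edge_colorable G \<mu> \<longleftrightarrow> (\<exists>l c. simultaneous_edge_coloring G \<mu> l c)"

lemma simple_graph_cartesian_product:
  assumes "simple_graph G" "simple_graph H"
  shows "simple_graph (G \<box> H)"
  using assms unfolding simple_graph_def cartesian_product_def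
  by (fastforce simp: card_2_iff doubleton_eq_iff)

end

theory Submission
  imports Defs "HOL-Combinatorics.Transposition"
begin

text \<open>
  A proper edge coloring \<open>c\<close> of a \<open>k\<close>-regular graph with \<open>k\<close> colors uses every color at every
  vertex, so its cyclic shifts \<open>c + i mod k\<close>, for \<open>i < k\<close>, form a simultaneous coloring. It
  remains to color \<open>G \<box> H\<close> with \<open>r + s\<close> colors. By Vizing's theorem, \<open>G\<close> has a proper coloring
  with \<open>r + 1\<close> colors; use it on every copy of \<open>G\<close>. At each vertex \<open>u\<close> of \<open>G\<close> some color is
  missing, and it is free for the edges of one matching of \<open>H\<close> in the copy of \<open>H\<close> over \<open>u\<close>.
  The other \<open>s - 1\<close> matchings get new colors. Vizing's theorem is proved with a maximal fan and
  one exchange of two colors along a Kempe chain.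
\<close>

section \<open>Vizing's theorem\<close>

text \<open>Colorings live on a bare edge set because the proof of Vizing's theorem moves single
  edges in and out of the colored set \<open>E\<close>; an uncolored edge is one outside
  \<open>E\<close>.\<close>

definition proper_on :: "'a set set \<Rightarrow> 'c set \<Rightarrow> ('a set \<Rightarrow> 'c) \<Rightarrow> bool" where
  "proper_on E C f \<longleftrightarrow> (\<forall>e\<in>E. f e \<in> C) \<and>
     (\<forall>e\<in>E. \<forall>e'\<in>E. e \<noteq> e' \<and> e \<inter> e' \<noteq> {} \<longrightarrow> f e \<noteq> f e')"

lemma proper_edge_coloring_iff: "proper_edge_coloring G l c \<longleftrightarrow> proper_on (edges G) {1..l} c"
  by (simp add: proper_edge_coloring_def proper_on_def)

lemma proper_onD: "\<lbrakk>proper_on E C f; e \<in> E; e' \<in> E; v \<in> e; v \<in> e'; f e = f e'\<rbrakk> \<Longrightarrow> e = e'"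
  unfolding proper_on_def by blast

definition missing :: "'a set set \<Rightarrow> 'c set \<Rightarrow> ('a set \<Rightarrow> 'c) \<Rightarrow> 'a \<Rightarrow> 'c set" where
  "missing E C f v = {a \<in> C. \<forall>e\<in>E. v \<in> e \<longrightarrow> f e \<noteq> a}"

lemma missing_nonempty:
  assumes "finite E" "card {e \<in> E. v \<in> e} < card C"
  shows "missing E C f v \<noteq> {}"
proof -
  have "card (f ` {e \<in> E. v \<in> e}) < card C"
    using card_image_le[of "{e \<in> E. v \<in> e}" f] assms by simp
  then have "\<not> C \<subseteq> f ` {e \<in> E. v \<in> e}"
    using assms(1) card_mono[of "f ` {e \<in> E. v \<in> e}" C] by fastforce
  then show ?thesis by (auto simp: missing_def)
qed

section \<open>Fans and their rotation\<close>

definition fan :: "'a set set \<Rightarrow> 'c set \<Rightarrow> ('a set \<Rightarrow> 'c) \<Rightarrow> 'a \<Rightarrow> 'a list \<Rightarrow> bool" where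
  "fan E C f x ys \<longleftrightarrow> ys \<noteq> [] \<and> {x, hd ys} \<notin> E \<and> x \<notin> set ys \<and> distinct ys \<and>
     (\<forall>i. Suc i < length ys \<longrightarrow>
        {x, ys ! Suc i} \<in> E \<and> f {x, ys ! Suc i} \<in> missing E C f (ys ! i))"

text \<open>Each fan edge can take the color of its successor, which is missing at its own end, and
  the last edge can take \<open>a\<close>, missing at both of its ends. The induction makes one such
  shift at a time: the uncolored edge moves along the fan while \<open>E\<close> and
  \<open>f\<close> change.\<close>

lemma fan_rotate:
  assumes "proper_on E C f" "fan E C f x ys"
    and "a \<in> missing E C f x" "a \<in> missing E C f (last ys)"
  shows "\<exists>g. proper_on (insert {x, hd ys} E) C g"
  using assms
proof (induction ys arbitrary: E f rule: induct_list012)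
  case 1
  then show ?case by (simp add: fan_def)
next
  case (2 y)
  then have "proper_on (insert {x, y} E) C (f({x, y} := a))"
    unfolding proper_on_def missing_def fan_def by auto
  then show ?case by auto
next
  case (3 y z zs)
  have xz: "{x, z} \<in> E" and xy: "{x, y} \<notin> E" and miss: "f {x, z} \<in> missing E C f y"
    and ne: "x \<noteq> y" "x \<noteq> z" "y \<noteq> z" "x \<notin> set zs" "y \<notin> set zs" "z \<notin> set zs" "distinct zs"
    using "3.prems"(2) by (force simp: fan_def)+
  have step: "{x, (z # zs) ! Suc i} \<in> E \<and> f {x, (z # zs) ! Suc i} \<in> missing E C f ((z # zs) ! i)"
    if "Suc i < length (z # zs)" for i
    using "3.prems"(2) that unfolding fan_def by force
  \<comment> \<open>\<open>{x, y}\<close> takes the color of \<open>{x, z}\<close>, which becomes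
    uncolored. This color is missing at \<open>y\<close>, and at \<open>x\<close> only
    \<open>{x, z}\<close> had it.\<close>
  define E1 where "E1 = insert {x, y} (E - {{x, z}})"
  define g where "g = f({x, y} := f {x, z})"
  have ne_xz: "f e \<noteq> f {x, z}" if "e \<in> E" "e \<noteq> {x, z}" "x \<in> e" for e
    using proper_onD[OF "3.prems"(1) that(1) xz that(3)] that(2) by auto
  have ne_xy: "g e \<noteq> g {x, y}" if e: "e \<in> E - {{x, z}}" "e \<inter> {x, y} \<noteq> {}" for e
  proof -
    have "f e \<noteq> f {x, z}" if "y \<in> e" using miss e that by (auto simp: missing_def)
    moreover have "e \<noteq> {x, y}" using e xy by blast
    ultimately show ?thesis using e ne_xz[of e] by (auto simp: g_def)
  qed
  have g_E: "g e = f e" if "e \<in> E" for e using that xy by (auto simp: g_def)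
  have proper: "proper_on E1 C g"
    unfolding proper_on_def
  proof (intro conjI ballI impI)
    fix e assume "e \<in> E1"
    then show "g e \<in> C"
      using "3.prems"(1) xz by (auto simp: proper_on_def E1_def g_def)
  next
    fix e e' assume *: "e \<in> E1" "e' \<in> E1" "e \<noteq> e' \<and> e \<inter> e' \<noteq> {}"
    then consider "e = {x, y}" "e' \<in> E - {{x, z}}" | "e' = {x, y}" "e \<in> E - {{x, z}}"
      | "e \<in> E" "e' \<in> E"
      by (auto simp: E1_def)
    then show "g e \<noteq> g e'"
    proof cases
      case 1
      then show ?thesis using ne_xy[of e'] * by (simp add: Int_commute eq_commute)
    next
      case 2
      then show ?thesis using ne_xy[of e] * by simp
    next
      case 3
      then show ?thesis using "3.prems"(1) * by (simp add: g_E proper_on_def)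
    qed
  qed
  \<comment> \<open>Only \<open>y\<close> can lose a missing color: at \<open>x\<close> the set of
    used colors stays the same, and \<open>z\<close> uses one color less. Since \<open>y\<close>
    does not recur, the rest is still a fan, and \<open>a\<close> is still missing at
    \<open>x\<close> and at the end.\<close>
  have missing_subset: "missing E C f v \<subseteq> missing E1 C g v" if "v \<noteq> y" for v
    using that xz unfolding missing_def E1_def g_def by auto
  have "{x, (z # zs) ! Suc i} \<in> E1 \<and> g {x, (z # zs) ! Suc i} \<in> missing E1 C g ((z # zs) ! i)"
    if i: "Suc i < length (z # zs)" for i
  proof -
    have mem: "(z # zs) ! Suc i \<in> set zs" "(z # zs) ! i \<in> set (z # zs)"
      using i nth_mem[of i "z # zs"] by auto
    then have "{x, (z # zs) ! Suc i} \<noteq> {x, y}" "{x, (z # zs) ! Suc i} \<noteq> {x, z}"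
      "(z # zs) ! i \<noteq> y"
      using ne by (auto simp: doubleton_eq_iff)
    then show ?thesis
      using step[OF i] missing_subset[of "(z # zs) ! i"] by (auto simp: E1_def g_def)
  qed
  moreover have "{x, z} \<notin> E1"
    using ne by (auto simp: E1_def doubleton_eq_iff)
  ultimately have "fan E1 C g x (z # zs)"
    using ne by (simp add: fan_def)
  moreover have "last (z # zs) \<noteq> y"
    using ne last_in_set[of "z # zs"] by auto
  ultimately have "\<exists>h. proper_on (insert {x, hd (z # zs)} E1) C h"
    using "3.IH"(2)[OF proper] "3.prems"(3,4) missing_subset ne(1) by auto
  moreover have "insert {x, hd (z # zs)} E1 = insert {x, hd (y # z # zs)} E"
    using xz by (auto simp: E1_def)
  ultimately show ?case by simp
qed

section \<open>Kempe chains and the exchange of two colors\<close>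

text \<open>The chain is traced by states \<open>(v, t)\<close>: the walk stands at \<open>v\<close> and leaves it along color \<open>b\<close>
  if \<open>t\<close> holds and along color \<open>a\<close> otherwise. This walk is deterministic, and a vertex other than
  \<open>x\<close> without color \<open>b\<close> can only be its end.\<close>

lemma kempe_chain:
  assumes proper: "proper_on E C f" and card2: "\<forall>e\<in>E. card e = 2"
    and "a \<noteq> b" and x: "a \<in> missing E C f x"
  obtains T where "x \<in> T" "\<And>e. \<lbrakk>e \<in> E; f e \<in> {a, b}; e \<inter> T \<noteq> {}\<rbrakk> \<Longrightarrow> e \<subseteq> T"
    "\<And>y z. \<lbrakk>y \<in> T; z \<in> T; y \<noteq> x; z \<noteq> x; b \<in> missing E C f y; b \<in> missing E C f z\<rbrakk> \<Longrightarrow> y = z"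
proof -
  define S where "S = {((v, t), (w, \<not> t)) | v w t.
    v \<noteq> w \<and> {v, w} \<in> E \<and> f {v, w} = (if t then b else a)}"
  define T where "T = {v. \<exists>t. ((x, True), (v, t)) \<in> S\<^sup>*}"
  have sv: "single_valued S"
  proof (rule single_valuedI)
    fix p q q' assume *: "(p, q) \<in> S" "(p, q') \<in> S"
    then obtain v t w w' where p: "p = (v, t)" "q = (w, \<not> t)" "q' = (w', \<not> t)" "v \<noteq> w" "v \<noteq> w'"
      "{v, w} \<in> E" "{v, w'} \<in> E" "f {v, w} = f {v, w'}"
      unfolding S_def by auto
    then have "{v, w} = {v, w'}"
      using proper_onD[OF proper, of "{v, w}" "{v, w'}" v] by simp
    then show "q = q'" using p by (auto simp: doubleton_eq_iff)
  qed
  \<comment> \<open>An edge at \<open>v\<close> in one of the two colors is either the one by which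
    the walk leaves or the one by which it came. At the start \<open>(x, True)\<close> the latter
    would have color \<open>a\<close>, which is missing at \<open>x\<close>.\<close>
  have nbr: "w \<in> T" if v: "v \<in> T" and e: "{v, w} \<in> E" "f {v, w} \<in> {a, b}" "v \<noteq> w" for v w
  proof -
    obtain t where t: "((x, True), (v, t)) \<in> S\<^sup>*" using v by (auto simp: T_def)
    show ?thesis
    proof (cases "f {v, w} = (if t then b else a)")
      case True
      then have "((v, t), (w, \<not> t)) \<in> S" using e by (auto simp: S_def)
      then show ?thesis using t by (auto simp: T_def intro: rtrancl_into_rtrancl)
    next
      case False
      from t show ?thesis
      proof (cases rule: rtranclE)
        case base
        then show ?thesis using False e x by (auto simp: missing_def)
      next
        case (step p)
        then obtain u where u: "p = (u, \<not> t)" "u \<noteq> v" "{u, v} \<in> E"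
          "f {u, v} = (if t then a else b)"
          by (auto simp: S_def)
        then have "{u, v} = {v, w}"
          using proper_onD[OF proper, of "{u, v}" "{v, w}" v] False e by (auto split: if_splits)
        then have "u = w" using u(2) by (auto simp: doubleton_eq_iff)
        then show ?thesis using step u by (auto simp: T_def)
      qed
    qed
  qed
  \<comment> \<open>Such a vertex is not entered along \<open>b\<close>, hence along
    \<open>a\<close>; the walk would have to leave along \<open>b\<close> and stops.\<close>
  have terminal: "((x, True), (y, True)) \<in> S\<^sup>* \<and> (\<forall>q. ((y, True), q) \<notin> S)"
    if y: "y \<in> T" "y \<noteq> x" "b \<in> missing E C f y" for y
  proof -
    have noedge: "f {y, w} \<noteq> b" if "{y, w} \<in> E" for w
      using y(3) that by (auto simp: missing_def)
    obtain t where t: "((x, True), (y, t)) \<in> S\<^sup>*" using y by (auto simp: T_def)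
    from t have t
    proof (cases rule: rtranclE)
      case base
      then show ?thesis using y by simp
    next
      case (step p)
      then show ?thesis using noedge by (auto simp: S_def insert_commute split: if_splits)
    qed
    then show ?thesis using t noedge by (auto simp: S_def)
  qed
  show thesis
  proof (rule that[of T])
    show "x \<in> T" by (auto simp: T_def)
  next
    fix e assume e: "e \<in> E" "f e \<in> {a, b}" "e \<inter> T \<noteq> {}"
    then obtain v where v: "v \<in> e" "v \<in> T" by blast
    obtain p q where "e = {p, q}" "p \<noteq> q"
      using card2 e(1) by (meson card_2_iff)
    then obtain w where "e = {v, w}" "v \<noteq> w" using v(1) by auto
    then show "e \<subseteq> T" using nbr[of v w] e v by auto
  next
    fix y z assume *: "y \<in> T" "z \<in> T" "y \<noteq> x" "z \<noteq> x"
      "b \<in> missing E C f y" "b \<in> missing E C f z"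
    \<comment> \<open>Of two states reached by a deterministic walk, one is reachable from the
      other; neither has a successor, so they coincide.\<close>
    have "((y, True), (z, True)) \<in> S\<^sup>* \<or> ((z, True), (y, True)) \<in> S\<^sup>*"
      using single_valued_confluent[OF sv] terminal * by blast
    then show "y = z"
      using terminal[of y] terminal[of z] * by (auto elim: converse_rtranclE)
  qed
qed

text \<open>Every edge meeting \<open>T\<close> is treated, also one that leaves \<open>T\<close>.
  For the sets \<open>T\<close> used here such an edge has neither of the two colors, so the
  transposition fixes its color.\<close>

definition swap_on :: "'a set \<Rightarrow> 'c \<Rightarrow> 'c \<Rightarrow> ('a set \<Rightarrow> 'c) \<Rightarrow> 'a set \<Rightarrow> 'c" where
  "swap_on T a b f e = (if e \<inter> T = {} then f e else transpose a b (f e))"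

lemma transpose_mem: "\<lbrakk>a \<in> C; b \<in> C; c \<in> C\<rbrakk> \<Longrightarrow> transpose a b c \<in> C"
  by (simp add: transpose_def)

text \<open>If one of two adjacent edges avoids \<open>T\<close>, the other is not contained in
  \<open>T\<close>, so both keep their colors. Otherwise both colors are transposed, and a
  transposition is injective.\<close>

lemma proper_on_swap:
  assumes proper: "proper_on E C f" and "a \<in> C" "b \<in> C"
    and closed: "\<And>e. \<lbrakk>e \<in> E; f e \<in> {a, b}; e \<inter> T \<noteq> {}\<rbrakk> \<Longrightarrow> e \<subseteq> T"
  shows "proper_on E C (swap_on T a b f)"
proof -
  have fixed: "swap_on T a b f e = f e" if "e \<in> E" "e \<inter> e' \<noteq> {}" "e' \<inter> T = {}" for e e'
    using closed[OF that(1)] that by (auto simp: swap_on_def transpose_def)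
  show ?thesis
    unfolding proper_on_def
  proof (intro conjI ballI impI)
    fix e assume "e \<in> E"
    then show "swap_on T a b f e \<in> C"
      using assms(1-3) by (auto simp: swap_on_def proper_on_def intro: transpose_mem)
  next
    fix e e' assume *: "e \<in> E" "e' \<in> E" "e \<noteq> e' \<and> e \<inter> e' \<noteq> {}"
    then have neq: "f e \<noteq> f e'" using proper by (auto simp: proper_on_def)
    show "swap_on T a b f e \<noteq> swap_on T a b f e'"
    proof (cases "e \<inter> T = {} \<or> e' \<inter> T = {}")
      case True
      then have "swap_on T a b f e = f e" "swap_on T a b f e' = f e'"
        using * by (metis fixed Int_commute swap_on_def)+
      then show ?thesis using neq by simp
    next
      case False
      then show ?thesis
        using neq transpose_eq_imp_eq[of a b "f e" "f e'"] by (auto simp: swap_on_def)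
    qed
  qed
qed

lemma missing_swap_inside:
  assumes "v \<in> T" "a \<in> C" "b \<in> C" "c \<in> missing E C f v"
  shows "transpose a b c \<in> missing E C (swap_on T a b f) v"
  using assms transpose_eq_imp_eq
  by (fastforce simp: missing_def swap_on_def intro: transpose_mem)

lemma missing_swap_outside:
  assumes "v \<notin> T" and "c \<in> missing E C f v"
    and closed: "\<And>e. \<lbrakk>e \<in> E; f e \<in> {a, b}; e \<inter> T \<noteq> {}\<rbrakk> \<Longrightarrow> e \<subseteq> T"
  shows "c \<in> missing E C (swap_on T a b f) v"
proof -
  have "swap_on T a b f e = f e" if "e \<in> E" "v \<in> e" for e
    using closed[OF that(1)] that assms(1) by (auto simp: swap_on_def transpose_def)
  then show ?thesis using assms(2) by (simp add: missing_def)
qed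

section \<open>Extending a coloring by one edge\<close>

lemma ex_maximal_fan:
  assumes "finite E" "\<forall>e\<in>E. card e = 2" "{x, y} \<notin> E" "x \<noteq> y"
  obtains ys where "fan E C f x ys" "hd ys = y"
    "\<And>z. \<not> fan E C f x (ys @ [z])"
proof -
  let ?P = "\<lambda>ys. fan E C f x ys \<and> hd ys = y"
  have fin: "finite (insert y (\<Union>E))"
  proof -
    have "finite e" if "e \<in> E" for e
      using that assms(2) card_ge_0_finite[of e] by simp
    then show ?thesis using assms(1) by simp
  qed
  \<comment> \<open>Fan vertices are distinct, and all but possibly the first lie on colored edges.
    This bounds the length, so a longest fan exists.\<close>
  have "length ys < Suc (card (insert y (\<Union>E)))" if "?P ys" for ys
  proof -
    have "ys ! i \<in> insert y (\<Union>E)" if "i < length ys" for i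
      using that \<open>?P ys\<close> by (cases i) (auto simp: fan_def hd_conv_nth)
    then have "set ys \<subseteq> insert y (\<Union>E)" by (metis in_set_conv_nth subsetI)
    then have "card (set ys) \<le> card (insert y (\<Union>E))" using fin card_mono by blast
    moreover have "card (set ys) = length ys"
      using \<open>?P ys\<close> by (simp add: fan_def distinct_card)
    ultimately show ?thesis by simp
  qed
  moreover have "?P [y]" using assms by (simp add: fan_def)
  ultimately obtain ys where ys: "?P ys" "\<And>zs. ?P zs \<Longrightarrow> length zs \<le> length ys"
    using ex_has_greatest_nat[of ?P "[y]" length "Suc (card (insert y (\<Union>E)))"] by metis
  have "\<not> fan E C f x (ys @ [z])" for z
    using ys(1) ys(2)[of "ys @ [z]"] by (auto simp: fan_def)
  then show thesis using that ys(1) by blast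
qed

text \<open>Let \<open>b\<close> be missing at the end of a maximal fan but not at \<open>x\<close>.
  Then \<open>b\<close> is also missing at some earlier fan vertex \<open>ys ! i\<close>. The Kempe
  chain of \<open>x\<close> contains at most one of these two vertices. Exchanging \<open>a\<close>
  and \<open>b\<close> on it makes \<open>b\<close> missing at \<open>x\<close>, and the fan, cut
  after \<open>ys ! i\<close> or whole, can be rotated towards the vertex off the chain.\<close>

lemma extend_coloring:
  assumes fin: "finite E" and card2: "\<forall>e\<in>E. card e = 2"
    and nonempty: "\<And>v. missing E C f v \<noteq> {}"
    and proper: "proper_on E C f" and xy: "{x, y} \<notin> E" "x \<noteq> y"
  shows "\<exists>g. proper_on (insert {x, y} E) C g"
proof -
  obtain ys where fan: "fan E C f x ys" and hd: "hd ys = y"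
    and maximal: "\<And>z. \<not> fan E C f x (ys @ [z])"
    using ex_maximal_fan[OF fin card2 xy] by metis
  obtain a where a: "a \<in> missing E C f x" using nonempty by blast
  obtain b where b: "b \<in> missing E C f (last ys)" using nonempty by blast
  show ?thesis
  proof (cases "b \<in> missing E C f x")
    case True
    then show ?thesis using fan_rotate[OF proper fan True b] hd by simp
  next
    case False
    have C: "a \<in> C" "b \<in> C" and ab: "a \<noteq> b" using a b False by (auto simp: missing_def)
    obtain e where e: "e \<in> E" "x \<in> e" "f e = b"
      using False C by (auto simp: missing_def)
    moreover from e(1) obtain p q where "e = {p, q}" "p \<noteq> q"
      using card2 e(1) by (meson card_2_iff)
    ultimately obtain z where "e = {x, z}" "z \<noteq> x" by auto
    then have z: "{x, z} \<in> E" "f {x, z} = b" "z \<noteq> x" using e by auto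
    \<comment> \<open>The color \<open>b\<close> of \<open>{x, z}\<close> is missing at
      \<open>last ys\<close>, so a new \<open>z\<close> could be appended to the fan.\<close>
    have "z \<in> set ys"
    proof (rule ccontr)
      assume "z \<notin> set ys"
      then have "fan E C f x (ys @ [z])"
        using fan z b
        by (auto simp: fan_def nth_append last_conv_nth less_Suc_eq)
          (metis One_nat_def diff_Suc_1)+
      then show False using maximal by blast
    qed
    then obtain j where j: "j < length ys" "ys ! j = z" by (metis in_set_conv_nth)
    \<comment> \<open>The edge from \<open>x\<close> to the head is uncolored, so \<open>z\<close>
      has a predecessor in the fan, and \<open>b\<close> is missing there.\<close>
    have "j \<noteq> 0" using j z fan by (metis fan_def hd_conv_nth)
    then obtain i where i: "Suc i < length ys" "ys ! Suc i = z" using j by (cases j) auto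
    have dist: "distinct ys" and x_ys: "x \<notin> set ys" using fan by (auto simp: fan_def)
    have b_i: "b \<in> missing E C f (ys ! i)" using fan i z by (auto simp: fan_def)
    have "ys \<noteq> []" using i by auto
    then have "ys ! i \<noteq> last ys"
      using i dist by (auto simp: last_conv_nth nth_eq_iff_index_eq)
    moreover have "ys ! i \<noteq> x" "last ys \<noteq> x"
      using x_ys i fan by (auto simp: fan_def)
    moreover obtain T where x_T: "x \<in> T"
      and closed: "\<And>e. \<lbrakk>e \<in> E; f e \<in> {a, b}; e \<inter> T \<noteq> {}\<rbrakk> \<Longrightarrow> e \<subseteq> T"
      and ends: "\<And>y z. \<lbrakk>y \<in> T; z \<in> T; y \<noteq> x; z \<noteq> x; b \<in> missing E C f y; b \<in> missing E C f z\<rbrakk>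
        \<Longrightarrow> y = z"
      using kempe_chain[OF proper card2 ab a] by metis
    ultimately have split: "ys ! i \<notin> T \<or> last ys \<notin> T" using b b_i by blast
    let ?g = "swap_on T a b f"
    have proper_g: "proper_on E C ?g" by (rule proper_on_swap[OF proper C closed])
    have b_x: "b \<in> missing E C ?g x"
      using missing_swap_inside[OF x_T C a] by simp
    have g_x: "?g {x, w} = transpose a b (f {x, w})" for w
      using x_T by (simp add: swap_on_def)
    \<comment> \<open>The other colored fan edges have neither color: \<open>a\<close> is missing at
      \<open>x\<close>, and \<open>b\<close> occurs at \<open>x\<close> only on
      \<open>{x, z}\<close>. So the exchange preserves their fan conditions, whether or not
      \<open>ys ! k\<close> is in \<open>T\<close>.\<close>
    have step: "{x, ys ! Suc k} \<in> E \<and> ?g {x, ys ! Suc k} \<in> missing E C ?g (ys ! k)"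
      if k: "Suc k < length ys" "k \<noteq> i" for k
    proof -
      have fk: "{x, ys ! Suc k} \<in> E" "f {x, ys ! Suc k} \<in> missing E C f (ys ! k)"
        using fan k by (auto simp: fan_def)
      have "f {x, ys ! Suc k} \<noteq> a" using a fk by (auto simp: missing_def)
      moreover have "f {x, ys ! Suc k} \<noteq> b"
      proof
        assume "f {x, ys ! Suc k} = b"
        then have "{x, ys ! Suc k} = {x, z}"
          using proper_onD[OF proper fk(1) z(1), of x] z by simp
        then have "ys ! Suc k = ys ! Suc i" using i by (auto simp: doubleton_eq_iff)
        then show False using dist i(1) k by (metis nat.inject nth_eq_iff_index_eq)
      qed
      ultimately have tr: "transpose a b (f {x, ys ! Suc k}) = f {x, ys ! Suc k}"
        by (simp add: transpose_def)
      then have "f {x, ys ! Suc k} \<in> missing E C ?g (ys ! k)"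
        using missing_swap_inside[OF _ C fk(2)] missing_swap_outside[OF _ fk(2) closed] by metis
      then show ?thesis using fk tr g_x by simp
    qed
    show ?thesis
    proof (cases "ys ! i \<in> T")
      case False
      \<comment> \<open>The cut fan ends before \<open>z\<close>, so the condition at index
        \<open>i\<close>, the only one not covered by \<open>step\<close>, drops out.\<close>
      have "fan E C ?g x (take (Suc i) ys)"
        using fan step i by (auto simp: fan_def dest: in_set_takeD)
      moreover have "last (take (Suc i) ys) = ys ! i"
        using i by (simp add: take_Suc_conv_app_nth)
      moreover have "b \<in> missing E C ?g (ys ! i)"
        using missing_swap_outside[OF False b_i closed] .
      ultimately show ?thesis
        using fan_rotate[OF proper_g _ b_x, of "take (Suc i) ys"] hd fan by simp
    next
      case True
      \<comment> \<open>Here the exchange turns both the color \<open>b\<close> of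
        \<open>{x, z}\<close> and the missing color \<open>b\<close> of \<open>ys ! i\<close> into
        \<open>a\<close>, so the condition at \<open>i\<close> survives as well.\<close>
      have "?g {x, ys ! Suc i} \<in> missing E C ?g (ys ! i)"
        using missing_swap_inside[OF True C b_i] g_x i z by simp
      then have "{x, ys ! Suc k} \<in> E \<and> ?g {x, ys ! Suc k} \<in> missing E C ?g (ys ! k)"
        if "Suc k < length ys" for k
        using step that i z by (cases "k = i") auto
      then have "fan E C ?g x ys" using fan by (simp add: fan_def)
      moreover have "b \<in> missing E C ?g (last ys)"
        using missing_swap_outside[OF _ b closed] split True by blast
      ultimately show ?thesis using fan_rotate[OF proper_g _ b_x] hd by blast
    qed
  qed
qed

theorem vizing:
  assumes "finite E" "\<forall>e\<in>E. card e = 2" "\<And>v. card {e \<in> E. v \<in> e} < card C"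
  shows "\<exists>f. proper_on E C f"
  using assms
proof (induction E rule: finite_induct)
  case empty
  then show ?case by (simp add: proper_on_def)
next
  case (insert e E)
  have deg: "card {e' \<in> E. v \<in> e'} < card C" for v
    using card_mono[of "{e' \<in> insert e E. v \<in> e'}" "{e' \<in> E. v \<in> e'}"] insert.hyps(1)
      insert.prems(2)[of v]
    by fastforce
  then obtain f where f: "proper_on E C f" using insert by auto
  obtain x y where "e = {x, y}" "x \<noteq> y" using insert.prems(1) by (auto simp: card_2_iff)
  then show ?case
    using extend_coloring[OF insert.hyps(1) _ missing_nonempty[OF insert.hyps(1) deg] f, of x y]
      insert by auto
qed

section \<open>Regular graphs colored with as many colors as their degree\<close>

lemma simple_graph_finite_edges: "simple_graph G \<Longrightarrow> finite (edges G)"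
  by (rule finite_subset[of _ "Pow (verts G)"]) (auto simp: simple_graph_def)

lemma proper_edge_coloring_inj_on_incident:
  "proper_edge_coloring G l c \<Longrightarrow> inj_on c (incident_edges G v)"
  unfolding proper_edge_coloring_def incident_edges_def inj_on_def by blast

lemma regular_coloring_uses_all_colors:
  assumes "regular G k" "proper_edge_coloring G k c" "v \<in> verts G"
  shows "c ` incident_edges G v = {1..k}"
proof (rule card_subset_eq)
  show "c ` incident_edges G v \<subseteq> {1..k}"
    using assms(2) by (auto simp: proper_edge_coloring_def incident_edges_def)
  show "card (c ` incident_edges G v) = card {1..k}"
    using assms proper_edge_coloring_inj_on_incident[OF assms(2), of v]
    by (simp add: card_image regular_def)
qed simp

text \<open>Used in two roles: for two adjacent edges under one shift, and for one edge under two
  shifts.\<close>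

lemma add_mod_cancel:
  fixes a b i k :: nat
  assumes "(a + i) mod k = (b + i) mod k" "a \<in> {1..k}" "b \<in> {1..k}"
  shows "a = b"
  using assms
proof (induction a b rule: linorder_wlog)
  case (le a b)
  then have "k dvd b - a"
    using mod_eq_dvd_iff_nat[of "a + i" "b + i" k] by simp
  moreover have "b - a < k" using le by auto
  ultimately have "b - a = 0" using nat_dvd_not_less by blast
  then show ?case using le by simp
next
  case (sym a b)
  then show ?case by simp
qed

lemma simultaneous_edge_colorable_if_regular_coloring:
  assumes reg: "regular G k" and c: "proper_edge_coloring G k c" and "\<mu> \<le> k"
  shows "simultaneous_edge_colorable G \<mu>"
proof -
  \<comment> \<open>\<open>Suc\<close> brings the residues back into the color set
    \<open>{1..k}\<close>.\<close>
  define d where "d i e = Suc ((c e + i) mod k)" for i e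
  have range: "c e \<in> {1..k}" if "e \<in> edges G" for e
    using c that by (simp add: proper_edge_coloring_def)
  have proper: "proper_edge_coloring G k (d i)" for i
    unfolding proper_edge_coloring_def
  proof (intro conjI ballI impI)
    fix e assume "e \<in> edges G"
    then have "0 < k" using range by fastforce
    then show "d i e \<in> {1..k}" by (simp add: d_def Suc_le_eq)
  next
    fix e e' assume *: "e \<in> edges G" "e' \<in> edges G" "e \<noteq> e' \<and> e \<inter> e' \<noteq> {}"
    then have "c e \<noteq> c e'" using c by (auto simp: proper_edge_coloring_def)
    then show "d i e \<noteq> d i e'"
      using add_mod_cancel[of "c e" i k "c e'"] range * by (auto simp: d_def)
  qed
  have "d i e \<noteq> d j e" if "i \<in> {1..\<mu>}" "j \<in> {1..\<mu>}" "i \<noteq> j" for i j e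
    using add_mod_cancel[of i "c e" k j] that \<open>\<mu> \<le> k\<close> by (auto simp: d_def add.commute)
  then have "simultaneous_edge_coloring G \<mu> k d"
    unfolding simultaneous_edge_coloring_def
    using proper regular_coloring_uses_all_colors[OF reg proper] by simp
  then show ?thesis unfolding simultaneous_edge_colorable_def by blast
qed

text \<open>Each matching of the factorization has exactly one edge at \<open>v\<close>, and each
  edge at \<open>v\<close> is in exactly one matching. So there are \<open>s\<close> matchings, and
  the index of its matching serves as the color of an edge.\<close>

lemma one_factorable_proper_coloring:
  assumes simple: "simple_graph H" and reg: "regular H s" and "one_factorable H"
    and v: "v \<in> verts H"
  shows "0 < s" "\<exists>p. proper_on (edges H) {..<s} p"
proof -
  obtain F where F: "F \<noteq> {}" "\<forall>M\<in>F. perfect_matching H M" "disjoint F"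
    "\<Union>F = edges H"
    using assms(3) unfolding one_factorable_def by metis
  have finE: "finite (edges H)" by (rule simple_graph_finite_edges[OF simple])
  have finF: "finite F" using finE unfolding F(4)[symmetric] by (rule finite_UnionD)
  define at where "at M = (THE e. e \<in> M \<and> v \<in> e)" for M
  have at: "at M \<in> M \<and> v \<in> at M" if "M \<in> F" for M
    using F(2) that v theI'[of "\<lambda>e. e \<in> M \<and> v \<in> e"]
    by (simp add: perfect_matching_def at_def)
  have uniq: "e = e'" if "M \<in> F" "e \<in> M" "e' \<in> M" "w \<in> e" "w \<in> e'" for M e e' w
  proof -
    have "e \<in> edges H" using F(4) that by blast
    then have "w \<in> verts H" using simple that by (auto simp: simple_graph_def)
    then show ?thesis using F(2) that unfolding perfect_matching_def by metis
  qed
  have same: "M = N" if "M \<in> F" "N \<in> F" "e \<in> M" "e \<in> N" for M N e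
    using disjointD[OF F(3)] that by blast
  have "bij_betw at F (incident_edges H v)"
    unfolding bij_betw_def
  proof
    show "inj_on at F" using at same by (metis inj_onI)
    show "at ` F = incident_edges H v"
    proof
      show "at ` F \<subseteq> incident_edges H v"
        using at F(4) by (auto simp: incident_edges_def)
      show "incident_edges H v \<subseteq> at ` F"
      proof
        fix e assume e: "e \<in> incident_edges H v"
        then obtain M where M: "M \<in> F" "e \<in> M"
          using F(4) by (auto simp: incident_edges_def)
        then have "e = at M" using uniq[OF M(1) M(2)] at e by (auto simp: incident_edges_def)
        then show "e \<in> at ` F" using M by blast
      qed
    qed
  qed
  then have card: "card F = s"
    using bij_betw_same_card reg v by (metis regular_def)
  \<comment> \<open>Positivity gives \<open>Suc r <= r + s\<close>, the room for the colors that
    Vizing's theorem uses on \<open>G\<close>.\<close>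
  then show "0 < s" using F(1) finF by (auto simp: card_gt_0_iff)
  obtain idx where idx: "bij_betw idx F {..<s}"
    using ex_bij_betw_finite_nat[OF finF] card by (auto simp: lessThan_atLeast0)
  define p where "p e = idx (THE M. M \<in> F \<and> e \<in> M)" for e
  have p: "p e = idx M" if "M \<in> F" "e \<in> M" for M e
    using that same the_equality[of "\<lambda>M. M \<in> F \<and> e \<in> M" M] by (metis p_def)
  have "proper_on (edges H) {..<s} p"
    unfolding proper_on_def
  proof (intro conjI ballI impI)
    fix e assume "e \<in> edges H"
    then show "p e \<in> {..<s}" using F(4) p idx by (metis UnionE bij_betwE)
  next
    fix e e' assume *: "e \<in> edges H" "e' \<in> edges H" "e \<noteq> e' \<and> e \<inter> e' \<noteq> {}"
    then obtain M N where MN: "M \<in> F" "e \<in> M" "N \<in> F" "e' \<in> N" using F(4) by (metis UnionE)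
    then have "M \<noteq> N" using * uniq by blast
    then show "p e \<noteq> p e'"
      using p MN idx by (metis bij_betw_imp_inj_on inj_on_eq_iff)
  qed
  then show "\<exists>p. proper_on (edges H) {..<s} p" by blast
qed

section \<open>Cartesian products\<close>

lemma verts_cartesian_product: "verts (G \<box> H) = verts G \<times> verts H"
  by (simp add: cartesian_product_def)

text \<open>With edges written as boxes, the images under \<open>fst\<close> and \<open>snd\<close>
  show which factor an edge comes from and recover the edge of that factor.\<close>

lemma edges_cartesian_product:
  assumes "simple_graph G" "simple_graph H"
  shows "edges (G \<box> H) = {e \<times> {v} | e v. e \<in> edges G \<and> v \<in> verts H} \<union>
    {{u} \<times> e | u e. u \<in> verts G \<and> e \<in> edges H}" (is "_ = ?A \<union> ?B")
proof
  show "edges (G \<box> H) \<subseteq> ?A \<union> ?B"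
  proof
    fix e assume "e \<in> edges (G \<box> H)"
    then obtain u v u' v' where e: "e = {(u, v), (u', v')}" "u \<in> verts G" "v \<in> verts H"
      "u = u' \<and> {v, v'} \<in> edges H \<or> {u, u'} \<in> edges G \<and> v = v'"
      by (auto simp: cartesian_product_def)
    from e(4) show "e \<in> ?A \<union> ?B"
    proof
      assume *: "u = u' \<and> {v, v'} \<in> edges H"
      then have "e = {u} \<times> {v, v'}" using e by auto
      then show ?thesis using * e by blast
    next
      assume *: "{u, u'} \<in> edges G \<and> v = v'"
      then have "e = {u, u'} \<times> {v}" using e by auto
      then show ?thesis using * e by blast
    qed
  qed
  have "e \<times> {v} \<in> edges (G \<box> H)" if e: "e \<in> edges G" "v \<in> verts H" for e v
  proof -
    obtain u u' where u: "e = {u, u'}" "u \<in> verts G" "u' \<in> verts G"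
      using e assms(1) by (auto simp: simple_graph_def card_2_iff)
    then have "e \<times> {v} = {(u, v), (u', v)}" by auto
    then show ?thesis using u e by (auto simp: cartesian_product_def)
  qed
  moreover have "{u} \<times> e \<in> edges (G \<box> H)" if e: "e \<in> edges H" "u \<in> verts G" for e u
  proof -
    obtain v v' where v: "e = {v, v'}" "v \<in> verts H" "v' \<in> verts H"
      using e assms(2) by (auto simp: simple_graph_def card_2_iff)
    then have "{u} \<times> e = {(u, v), (u, v')}" by auto
    then show ?thesis using v e by (auto simp: cartesian_product_def)
  qed
  ultimately show "?A \<union> ?B \<subseteq> edges (G \<box> H)" by blast
qed

lemma regular_cartesian_product:
  assumes "simple_graph G" "simple_graph H" "regular G r" "regular H s"
  shows "regular (G \<box> H) (r + s)"
  unfolding regular_def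
proof
  fix w assume "w \<in> verts (G \<box> H)"
  then obtain u v where w: "w = (u, v)" "u \<in> verts G" "v \<in> verts H"
    by (auto simp: verts_cartesian_product)
  let ?A = "(\<lambda>e. e \<times> {v}) ` incident_edges G u" and ?B = "(\<lambda>e. {u} \<times> e) ` incident_edges H v"
  have "incident_edges (G \<box> H) w = ?A \<union> ?B"
    unfolding incident_edges_def edges_cartesian_product[OF assms(1,2)] w(1)
    using w(2,3) by auto
  moreover have "?A \<inter> ?B = {}"
  proof -
    have "e \<times> {v} \<noteq> {u} \<times> e'" if "e \<in> edges G" "u \<in> e" for e e'
    proof
      assume eq: "e \<times> {v} = {u} \<times> e'"
      have "e \<subseteq> {u}"
      proof
        fix z assume "z \<in> e"
        then have "(z, v) \<in> {u} \<times> e'" unfolding eq[symmetric] by simp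
        then show "z \<in> {u}" by simp
      qed
      then show False using assms(1) that card_mono[of "{u}" e] by (simp add: simple_graph_def)
    qed
    then show ?thesis by (auto simp: incident_edges_def)
  qed
  moreover have "finite (incident_edges G u)" "finite (incident_edges H v)"
    using simple_graph_finite_edges[OF assms(1)] simple_graph_finite_edges[OF assms(2)]
    by (simp_all add: incident_edges_def)
  moreover have "inj_on (\<lambda>e. e \<times> {v}) (incident_edges G u)"
    "inj_on (\<lambda>e. {u} \<times> e) (incident_edges H v)"
    by (auto simp: inj_on_def)
  ultimately show "card (incident_edges (G \<box> H) w) = r + s"
    using assms(3,4) w by (simp add: card_Un_disjoint card_image regular_def)
qed

lemma cartesian_product_coloring:
  assumes simple: "simple_graph G" "simple_graph H"
    and f: "proper_on (edges G) {1..Suc r} f"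
    and m: "\<And>u. u \<in> verts G \<Longrightarrow> m u \<in> missing (edges G) {1..Suc r} f u"
    and p: "proper_on (edges H) {..<s} p" and "0 < s"
  shows "\<exists>c. proper_edge_coloring (G \<box> H) (r + s) c"
proof -
  \<comment> \<open>A singleton first projection marks an edge from \<open>H\<close>. Matching
    \<open>0\<close> gets the color missing at \<open>u\<close>; the matchings \<open>1\<close> to
    \<open>s - 1\<close> get \<open>r + 2\<close> to \<open>r + s\<close>, above all colors of
    \<open>f\<close>.\<close>
  define c where "c E = (if is_singleton (fst ` E)
    then if p (snd ` E) = 0 then m (the_elem (fst ` E)) else Suc r + p (snd ` E)
    else f (fst ` E))" for E
  have c_G: "c (e \<times> {v}) = f e" if "e \<in> edges G" for e v
  proof -
    have "\<not> is_singleton e" using simple(1) that by (auto simp: simple_graph_def is_singleton_altdef)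
    then show ?thesis by (simp add: c_def)
  qed
  have c_H: "c ({u} \<times> e) = (if p e = 0 then m u else Suc r + p e)" if "e \<in> edges H" for e u
  proof -
    have "e \<noteq> {}" using simple(2) that by (auto simp: simple_graph_def)
    then show ?thesis by (simp add: c_def)
  qed
  have f_range: "f e \<in> {1..Suc r}" if "e \<in> edges G" for e
    using f that by (simp add: proper_on_def)
  have m_range: "m u \<in> {1..Suc r}" if "u \<in> verts G" for u
    using m[OF that] by (simp add: missing_def)
  \<comment> \<open>The two edges share a vertex, so \<open>u\<close> is an end of \<open>e\<close>
    and \<open>f e\<close> differs from the missing color \<open>m u\<close>; all other colors on
    the copies of \<open>H\<close> exceed \<open>Suc r\<close>.\<close>
  have GH: "c (e \<times> {v}) \<noteq> c ({u} \<times> e')"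
    if "e \<in> edges G" "e' \<in> edges H" "u \<in> verts G" "(e \<times> {v}) \<inter> ({u} \<times> e') \<noteq> {}" for e v u e'
  proof -
    have "u \<in> e" using that(4) by blast
    then have "f e \<noteq> m u" using m[OF that(3)] that(1) by (auto simp: missing_def)
    then show ?thesis using f_range[OF that(1)] by (simp add: c_G[OF that(1)] c_H[OF that(2)])
  qed
  have edge_cases: "(\<exists>e v. E = e \<times> {v} \<and> e \<in> edges G) \<or>
      (\<exists>u e. E = {u} \<times> e \<and> u \<in> verts G \<and> e \<in> edges H)" if "E \<in> edges (G \<box> H)" for E
    using that unfolding edges_cartesian_product[OF simple] by blast
  have "proper_on (edges (G \<box> H)) {1..r + s} c"
    unfolding proper_on_def
  proof (intro conjI ballI impI)
    fix E assume "E \<in> edges (G \<box> H)"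
    then consider e v where "E = e \<times> {v}" "e \<in> edges G"
      | u e where "E = {u} \<times> e" "u \<in> verts G" "e \<in> edges H"
      using edge_cases by metis
    then show "c E \<in> {1..r + s}"
    proof cases
      case 1
      then show ?thesis using f_range[of e] \<open>0 < s\<close> by (auto simp: c_G)
    next
      case 2
      then have "p e < s" using p by (auto simp: proper_on_def)
      then show ?thesis using 2 m_range[of u] \<open>0 < s\<close> by (auto simp: c_H)
    qed
  next
    fix E E' assume "E \<in> edges (G \<box> H)" "E' \<in> edges (G \<box> H)" and *: "E \<noteq> E' \<and> E \<inter> E' \<noteq> {}"
    then consider e v e' v' where "E = e \<times> {v}" "e \<in> edges G" "E' = e' \<times> {v'}" "e' \<in> edges G"
      | e v u e' where "E = e \<times> {v}" "e \<in> edges G" "E' = {u} \<times> e'" "u \<in> verts G" "e' \<in> edges H"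
      | e v u e' where "E' = e \<times> {v}" "e \<in> edges G" "E = {u} \<times> e'" "u \<in> verts G" "e' \<in> edges H"
      | u e u' e' where "E = {u} \<times> e" "u \<in> verts G" "e \<in> edges H"
        "E' = {u'} \<times> e'" "u' \<in> verts G" "e' \<in> edges H"
      using edge_cases[of E] edge_cases[of E'] by metis
    then show "c E \<noteq> c E'"
    proof cases
      case 1
      then have "e \<noteq> e'" "e \<inter> e' \<noteq> {}" using * by auto
      then show ?thesis using 1 f by (auto simp: c_G proper_on_def)
    next
      case 2
      then show ?thesis using GH[of e e' u v] * by simp
    next
      case 3
      then show ?thesis using GH[of e e' u v] * by (simp add: Int_commute eq_commute)
    next
      case 4
      \<comment> \<open>Meeting edges from \<open>H\<close> lie in the same copy, so
        \<open>m\<close> contributes the single value \<open>m u\<close>, at most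
        \<open>Suc r\<close>.\<close>
      then have "u = u'" "e \<noteq> e'" "e \<inter> e' \<noteq> {}" using * by auto
      moreover from this have "p e \<noteq> p e'" using 4 p by (simp add: proper_on_def)
      ultimately show ?thesis using 4 m_range[of u] by (auto simp: c_H)
    qed
  qed
  then show ?thesis by (auto simp: proper_edge_coloring_iff)
qed

theorem theorem2p12:
  fixes G :: "'a ugraph" and H :: "'b ugraph" and r s \<mu> :: nat
  assumes "simple_graph G" and "simple_graph H"
    and "regular G r" and "regular H s"
    and "one_factorable H"
    and "1 \<le> \<mu>" and "\<mu> \<le> r + s"
  shows "simultaneous_edge_colorable (G \<box> H) \<mu>"
proof (cases "verts H = {}")
  \<comment> \<open>Without a vertex in \<open>H\<close>, regularity does not tie \<open>s\<close>
    to the number of matchings, but the product is empty.\<close>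
  case True
  then have "verts (G \<box> H) = {}" "edges (G \<box> H) = {}"
    by (auto simp: cartesian_product_def)
  then show ?thesis
    by (simp add: simultaneous_edge_colorable_def simultaneous_edge_coloring_def
      proper_edge_coloring_def)
next
  case False
  then obtain v where v: "v \<in> verts H" by blast
  obtain p where p: "proper_on (edges H) {..<s} p" and "0 < s"
    using one_factorable_proper_coloring[OF assms(2,4,5) v] by blast
  have deg: "card {e \<in> edges G. u \<in> e} < card {1..Suc r}" for u
  proof (cases "u \<in> verts G")
    case True
    then show ?thesis using assms(3) by (simp add: regular_def incident_edges_def)
  next
    case False
    then have "{e \<in> edges G. u \<in> e} = {}" using assms(1) by (auto simp: simple_graph_def)
    then show ?thesis by (metis card.empty card_atLeastAtMost diff_Suc_1 zero_less_Suc)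
  qed
  have fin: "finite (edges G)" by (rule simple_graph_finite_edges[OF assms(1)])
  obtain f :: "'a set \<Rightarrow> nat" where f: "proper_on (edges G) {1..Suc r} f"
    using vizing[OF fin _ deg] assms(1) by (auto simp: simple_graph_def)
  have "\<exists>a. a \<in> missing (edges G) {1..Suc r} f u" for u
    using missing_nonempty[OF fin deg] by blast
  then obtain m where "\<And>u. m u \<in> missing (edges G) {1..Suc r} f u" by metis
  then obtain c where "proper_edge_coloring (G \<box> H) (r + s) c"
    using cartesian_product_coloring[OF assms(1,2) f _ p \<open>0 < s\<close>] by blast
  then show ?thesis
    using simultaneous_edge_colorable_if_regular_coloring[OF regular_cartesian_product[OF assms(1-4)]]
      assms(7) by blast
qed

end
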